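(* (Conformable Lagrange identity.) If $x,y\in\mathbb D$, then $$x\,(Ly)-y\,(Lx)=D^{\alpha}[pW(x,y)]+\kappa_1\,pW(x,y)\qquad\text{on }\mathcal I.$$ Equivalently, for fixed $b\in\mathcal I$ and all $t\in\mathcal I$, $$e_0(t,b)\,D^{\alpha}\left[\frac{pW(x,y)(t)}{e_0(t,b)}\right]=x(t)(Ly)(t)-y(t)(Lx)(t).$$
   Context: $\mathcal I\subseteq\mathbb R$ is a nondegenerate interval. The functions $\kappa_0,\kappa_1:[0,1]\times\mathcal I\to[0,\infty)$ are continuous and satisfy, for all $t\in\mathcal I$: $\lim_{\alpha\to0^+}\kappa_1(\alpha,t)=1$, $\lim_{\alpha\to0^+}\kappa_0(\alpha,t)=0$, $\lim_{\alpha\to1^-}\kappa_1(\alpha,t)=0$, $\lim_{\alpha\to1^-}\kappa_0(\alpha,t)=1$, $\kappa_1(\alpha,t)\ne0$ for $\alpha\in[0,1)$, and $\kappa_0(\alpha,t)\neq0$ for $\alpha\in(0,1]$. Fix $\alpha\in(0,1]$ and write $\kappa_j(t)=\kappa_j(\alpha,t)$. The conformable (proportional) derivative is $D^{\alpha}f(t)=\kappa_1(t)f(t)+\kappa_0(t)f'(t)$. For $t,s\in\mathcal I$, $e_0(t,s)=\exp\left(-\int_s^t\frac{\kappa_1(\tau)}{\kappa_0(\tau)}\,d\tau\right)$. Let $p,q$ be continuous on $\mathcal I$ with $p(t)>0$ for all $t\in\mathcal I$, and set $Lx=D^{\alpha}[pD^{\alpha}x]+qx$. $\mathbb D$ is the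 set of all continuous functions $x$ on $\mathcal I$ such that $D^{\alpha}x$ and $D^{\alpha}[pD^{\alpha}x]$ exist and are continuous on $\mathcal I$. The conformable Wronskian is $W(x,y)=xD^{\alpha}y-yD^{\alpha}x$. *)

theory Defs
  imports "HOL-Analysis.Analysis"
begin

definition nondegenerate_interval :: "real set \<Rightarrow> bool" where
  "nondegenerate_interval I \<longleftrightarrow> is_interval I \<and> (\<exists>a\<in>I. \<exists>b\<in>I. a < b)"

text \<open>The kernels are curried functions of \<open>\<alpha>\<close> and \<open>t\<close>, so that \<open>\<kappa> \<alpha>\<close> is the one-variable
  function written \<open>\<kappa>(t)\<close> once \<open>\<alpha>\<close> is fixed. Their values outside \<open>[0,1] \<times> I\<close> are irrelevant.\<close>

definition conformable_kernels ::
    "real set \<Rightarrow> (real \<Rightarrow> real \<Rightarrow> real) \<Rightarrow> (real \<Rightarrow> real \<Rightarrow> real) \<Rightarrow> bool" where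
  "conformable_kernels I \<kappa>0 \<kappa>1 \<longleftrightarrow>
     continuous_on ({0..1} \<times> I) (\<lambda>(\<alpha>, t). \<kappa>0 \<alpha> t) \<and>
     continuous_on ({0..1} \<times> I) (\<lambda>(\<alpha>, t). \<kappa>1 \<alpha> t) \<and>
     (\<forall>\<alpha>\<in>{0..1}. \<forall>t\<in>I. 0 \<le> \<kappa>0 \<alpha> t \<and> 0 \<le> \<kappa>1 \<alpha> t) \<and>
     (\<forall>t\<in>I.
        ((\<lambda>\<alpha>. \<kappa>1 \<alpha> t) \<longlongrightarrow> 1) (at_right 0) \<and>
        ((\<lambda>\<alpha>. \<kappa>0 \<alpha> t) \<longlongrightarrow> 0) (at_right 0) \<and>
        ((\<lambda>\<alpha>. \<kappa>1 \<alpha> t) \<longlongrightarrow> 0) (at_left 1) \<and>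
        ((\<lambda>\<alpha>. \<kappa>0 \<alpha> t) \<longlongrightarrow> 1) (at_left 1) \<and>
        (\<forall>\<alpha>\<in>{0..<1}. \<kappa>1 \<alpha> t \<noteq> 0) \<and>
        (\<forall>\<alpha>\<in>{0<..1}. \<kappa>0 \<alpha> t \<noteq> 0))"

text \<open>From here on \<open>k0\<close>, \<open>k1\<close> are the one-variable functions for a fixed \<open>\<alpha>\<close>. Derivatives are
  taken within \<open>I\<close>, hence one-sided at endpoints belonging to \<open>I\<close>. As \<^const>\<open>vector_derivative\<close> is
  total, the value of \<open>conf_deriv\<close> is meaningful only where \<open>f\<close> is differentiable; existence of the
  conformable derivative on \<open>I\<close> is expressed separately by \<open>f differentiable_on I\<close>.\<close>

definition conf_deriv ::
    "(real \<Rightarrow> real) \<Rightarrow> (real \<Rightarrow> real) \<Rightarrow> real set \<Rightarrow> (real \<Rightarrow> real) \<Rightarrow> real \<Rightarrow> real" where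
  "conf_deriv k0 k1 I f t = k1 t * f t + k0 t * vector_derivative f (at t within I)"

text \<open>The interval integral is oriented, so \<open>t < s\<close> is covered with the usual sign.\<close>

definition conf_exp0 :: "(real \<Rightarrow> real) \<Rightarrow> (real \<Rightarrow> real) \<Rightarrow> real \<Rightarrow> real \<Rightarrow> real" where
  "conf_exp0 k0 k1 t s = exp (- (LBINT \<tau>=ereal s..ereal t. k1 \<tau> / k0 \<tau>))"

definition conf_L ::
    "(real \<Rightarrow> real) \<Rightarrow> (real \<Rightarrow> real) \<Rightarrow> real set \<Rightarrow> (real \<Rightarrow> real) \<Rightarrow> (real \<Rightarrow> real) \<Rightarrow>
     (real \<Rightarrow> real) \<Rightarrow> real \<Rightarrow> real" where
  "conf_L k0 k1 I p q x t =
     conf_deriv k0 k1 I (\<lambda>s. p s * conf_deriv k0 k1 I x s) t + q t * x t"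

definition conf_domain ::
    "(real \<Rightarrow> real) \<Rightarrow> (real \<Rightarrow> real) \<Rightarrow> real set \<Rightarrow> (real \<Rightarrow> real) \<Rightarrow> (real \<Rightarrow> real) set" where
  "conf_domain k0 k1 I p =
     {x. continuous_on I x \<and>
         x differentiable_on I \<and>
         continuous_on I (conf_deriv k0 k1 I x) \<and>
         (\<lambda>s. p s * conf_deriv k0 k1 I x s) differentiable_on I \<and>
         continuous_on I (conf_deriv k0 k1 I (\<lambda>s. p s * conf_deriv k0 k1 I x s))}"

definition conf_wronskian ::
    "(real \<Rightarrow> real) \<Rightarrow> (real \<Rightarrow> real) \<Rightarrow> real set \<Rightarrow> (real \<Rightarrow> real) \<Rightarrow> (real \<Rightarrow> real) \<Rightarrow>
     real \<Rightarrow> real" where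
  "conf_wronskian k0 k1 I x y t = x t * conf_deriv k0 k1 I y t - y t * conf_deriv k0 k1 I x t"

end

theory Submission
  imports Defs
begin

text \<open>Put \<open>u = p D\<^sup>\<alpha>y\<close> and \<open>v = p D\<^sup>\<alpha>x\<close>, so that \<open>p W = x u - y v\<close> is visibly differentiable even
  though \<open>p\<close> need not be. The terms of \<open>(p W)'\<close> with \<open>x'\<close> and \<open>y'\<close> contribute
  \<open>\<kappa>0 (x' u - y' v) = (D\<^sup>\<alpha>x - \<kappa>1 x) u - (D\<^sup>\<alpha>y - \<kappa>1 y) v = - \<kappa>1 p W\<close>, which is the defect in the
  identity. Since \<open>e0' = - (\<kappa>1 / \<kappa>0) e0\<close>, dividing by \<open>e0\<close> before differentiating absorbs the
  term \<open>\<kappa>1 p W\<close>.\<close>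

text \<open>The filter depends only on the points of \<open>I\<close> near \<open>t\<close>, so
  \<open>I\<close> may be replaced by a compact subinterval. Making it contain \<open>b\<close>
  allows the fundamental theorem of calculus with base point \<open>b\<close> to be applied there,
  also when \<open>t\<close> is an endpoint of \<open>I\<close>.\<close>

lemma at_within_interval_eq_at_within_Icc:
  fixes I :: "real set"
  assumes "is_interval I" "t \<in> I" "b \<in> I"
  obtains c d where "c \<le> t" "t \<le> d" "c \<le> b" "b \<le> d" "{c..d} \<subseteq> I"
    "at t within I = at t within {c..d}"
proof -
  have conv: "z \<in> I" if "x \<in> I" "y \<in> I" "x \<le> z" "z \<le> y" for x y z
    using assms(1) that unfolding is_interval_1 by blast
  \<comment> \<open>\<open>l\<close> is the left end and \<open>l'\<close> bounds a window around
    \<open>t\<close>: any point of \<open>I\<close> below \<open>t\<close> serves as both. If there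
    is none, \<open>t\<close> itself is the left end and \<open>t - 1\<close> is an arbitrary number
    below it. The right side is symmetric.\<close>
  obtain l l' where l: "l \<in> I" "l \<le> t" "l' < t" "\<And>z. z \<in> I \<Longrightarrow> l' < z \<Longrightarrow> l \<le> z"
  proof (cases "\<exists>s\<in>I. s < t")
    case True
    then show ?thesis using that less_imp_le by blast
  next
    case False
    show ?thesis
    proof (rule that[of t "t - 1"])
      show "t \<le> z" if "z \<in> I" for z using False that by (meson not_le)
    qed (use assms(2) in auto)
  qed
  obtain u u' where u: "u \<in> I" "t \<le> u" "t < u'" "\<And>z. z \<in> I \<Longrightarrow> z < u' \<Longrightarrow> z \<le> u"
  proof (cases "\<exists>s\<in>I. t < s")
    case True
    then show ?thesis using that less_imp_le by blast
  next
    case False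
    show ?thesis
    proof (rule that[of t "t + 1"])
      show "z \<le> t" if "z \<in> I" for z using False that by (meson not_le)
    qed (use assms(2) in auto)
  qed
  \<comment> \<open>Stretching the ends to reach \<open>b\<close> is harmless: the interval stays
    between \<open>{l..u}\<close> and \<open>I\<close>, which already agree on the window from
    \<open>l'\<close> to \<open>u'\<close>.\<close>
  let ?c = "min l b" and ?d = "max u b"
  have sub: "{?c..?d} \<subseteq> I"
  proof
    fix z assume "z \<in> {?c..?d}"
    moreover have "?c \<in> I" "?d \<in> I" using l(1) u(1) assms(3) by (simp_all add: min_def max_def)
    ultimately show "z \<in> I" using conv[of ?c ?d z] by simp
  qed
  have "at t within I = at t within {?c..?d}"
  proof (rule at_within_nhd)
    show "t \<in> {l'<..<u'}" using l u by simp
    show "I \<inter> {l'<..<u'} - {t} = {?c..?d} \<inter> {l'<..<u'} - {t}"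
    proof -
      have "z \<in> {?c..?d}" if "z \<in> I" "z \<in> {l'<..<u'}" for z
        using l(4)[of z] u(4)[of z] that by (simp add: min_le_iff_disj le_max_iff_disj)
      then show ?thesis using sub by blast
    qed
  qed simp
  then show thesis using sub l(2) u(2)
    by (intro that[of ?c ?d]) (simp_all add: min_le_iff_disj le_max_iff_disj)
qed

text \<open>At \<open>t\<close> the filter is that of a compact interval containing both
  \<open>b\<close> and \<open>t\<close>, where \<open>interval_integral_FTC2\<close> applies. The
  integral is oriented, so \<open>t\<close> may lie on either side of \<open>b\<close>.\<close>

lemma interval_integral_has_real_derivative_within:
  fixes f :: "real \<Rightarrow> real"
  assumes "is_interval I" "continuous_on I f" "b \<in> I" "t \<in> I"
  shows "((\<lambda>s. LBINT \<tau>=ereal b..ereal s. f \<tau>) has_real_derivative f t) (at t within I)"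
proof -
  obtain c d where cd: "c \<le> t" "t \<le> d" "c \<le> b" "b \<le> d" "{c..d} \<subseteq> I"
    "at t within I = at t within {c..d}"
    using at_within_interval_eq_at_within_Icc assms by metis
  have "((\<lambda>s. LBINT \<tau>=b..s. f \<tau>) has_vector_derivative f t) (at t within {c..d})"
    using cd continuous_on_subset[OF assms(2)] by (intro interval_integral_FTC2) auto
  then show ?thesis
    using cd by (simp add: has_real_derivative_iff_has_vector_derivative)
qed

text \<open>A connected set with two distinct points has no isolated point. Nontriviality of the
  filter is what makes derivatives within \<open>I\<close> unique, endpoints included.\<close>

lemma at_within_nondegenerate_interval_neq_bot:
  assumes "nondegenerate_interval I" "t \<in> I"
  shows "at t within I \<noteq> bot"
proof -
  obtain a b where "a \<in> I" "b \<in> I" "a < b"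
    using assms(1) unfolding nondegenerate_interval_def by blast
  moreover have "connected I"
    using assms(1) is_interval_connected_1 unfolding nondegenerate_interval_def by blast
  ultimately have "t islimpt I"
    using assms(2) connected_imp_perfect[of I t] by auto
  then show ?thesis by (simp add: trivial_limit_within)
qed

text \<open>Uniqueness of the derivative forces the total function \<open>vector_derivative\<close>
  to return \<open>f'\<close>.\<close>

lemma conf_deriv_eqI:
  assumes "at t within I \<noteq> bot" "(f has_real_derivative f') (at t within I)"
  shows "conf_deriv k0 k1 I f t = k1 t * f t + k0 t * f'"
  using vector_derivative_within[OF assms(1)] assms(2)
  unfolding conf_deriv_def has_real_derivative_iff_has_vector_derivative by metis

lemma differentiable_on_imp_has_real_derivative:
  fixes f :: "real \<Rightarrow> real"
  assumes "f differentiable_on I" "t \<in> I"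
  shows "(f has_real_derivative vector_derivative f (at t within I)) (at t within I)"
  using assms vector_derivative_works
  by (auto simp: differentiable_on_def has_real_derivative_iff_has_vector_derivative)

lemma conf_exp0_has_real_derivative:
  assumes "is_interval I" "continuous_on I k0" "continuous_on I k1"
    "\<And>s. s \<in> I \<Longrightarrow> k0 s \<noteq> 0" "b \<in> I" "t \<in> I"
  shows "((\<lambda>s. conf_exp0 k0 k1 s b) has_real_derivative - (k1 t / k0 t) * conf_exp0 k0 k1 t b)
    (at t within I)"
proof -
  have "continuous_on I (\<lambda>\<tau>. k1 \<tau> / k0 \<tau>)"
    using assms by (intro continuous_on_divide) auto
  from interval_integral_has_real_derivative_within[OF assms(1) this assms(5,6)]
  have "((\<lambda>s. - (LBINT \<tau>=ereal b..ereal s. k1 \<tau> / k0 \<tau>)) has_real_derivative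
      - (k1 t / k0 t)) (at t within I)"
    by (rule DERIV_minus)
  from DERIV_chain2[OF DERIV_exp this] show ?thesis
    unfolding conf_exp0_def by (simp only: mult.commute)
qed

lemma continuous_on_slice:
  assumes "continuous_on (A \<times> B) (\<lambda>(a, t). f a t)" "a \<in> A"
  shows "continuous_on B (f a)"
proof -
  have "continuous_on B (\<lambda>t. case (a, t) of (a, t) \<Rightarrow> f a t)"
    by (rule continuous_on_compose2[OF assms(1)]) (auto intro!: continuous_intros assms(2))
  then show ?thesis by simp
qed

text \<open>The factor 2 has two sources. Since \<open>k0 u' = D u - k1 u\<close>, and likewise for
  \<open>v\<close>, the terms with \<open>u'\<close> and \<open>v'\<close> give
  \<open>x Ly - y Lx - k1 p W\<close>, the \<open>q\<close> terms cancelling; the terms with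
  \<open>x'\<close> and \<open>y'\<close> give another \<open>- k1 p W\<close>.\<close>

lemma conf_wronskian_has_real_derivative:
  assumes "x \<in> conf_domain k0 k1 I p" "y \<in> conf_domain k0 k1 I p" "t \<in> I" "k0 t \<noteq> 0"
  shows "((\<lambda>s. p s * conf_wronskian k0 k1 I x y s) has_real_derivative
    (x t * conf_L k0 k1 I p q y t - y t * conf_L k0 k1 I p q x t
      - 2 * k1 t * (p t * conf_wronskian k0 k1 I x y t)) / k0 t) (at t within I)"
proof -
  let ?u = "\<lambda>s. p s * conf_deriv k0 k1 I y s" and ?v = "\<lambda>s. p s * conf_deriv k0 k1 I x s"
  let ?d = "\<lambda>f. vector_derivative f (at t within I)"
  have "(x has_real_derivative ?d x) (at t within I)"
    "(y has_real_derivative ?d y) (at t within I)"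
    "(?u has_real_derivative ?d ?u) (at t within I)"
    "(?v has_real_derivative ?d ?v) (at t within I)"
    using assms by (auto simp: conf_domain_def
        intro!: differentiable_on_imp_has_real_derivative)
  then have "((\<lambda>s. x s * ?u s - y s * ?v s) has_real_derivative
      (?d x * ?u t + ?d ?u * x t) - (?d y * ?v t + ?d ?v * y t)) (at t within I)"
    by (intro DERIV_diff DERIV_mult)
  moreover have "(\<lambda>s. x s * ?u s - y s * ?v s) = (\<lambda>s. p s * conf_wronskian k0 k1 I x y s)"
    by (auto simp: conf_wronskian_def algebra_simps)
  moreover have "(?d x * ?u t + ?d ?u * x t) - (?d y * ?v t + ?d ?v * y t) =
      (x t * conf_L k0 k1 I p q y t - y t * conf_L k0 k1 I p q x t
        - 2 * k1 t * (p t * conf_wronskian k0 k1 I x y t)) / k0 t"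
  proof -
    have "k0 t * ((?d x * ?u t + ?d ?u * x t) - (?d y * ?v t + ?d ?v * y t)) =
        x t * conf_L k0 k1 I p q y t - y t * conf_L k0 k1 I p q x t
          - 2 * k1 t * (p t * conf_wronskian k0 k1 I x y t)"
      \<comment> \<open>The unfolding is selective: the inner conformable derivatives are expanded
        only at the point \<open>t\<close>. Under the binders of \<open>?u\<close> and
        \<open>?v\<close> they stay folded, so that \<open>?d ?u\<close> and \<open>?d ?v\<close>
        remain matching atoms on both sides.\<close>
      unfolding conf_L_def conf_wronskian_def conf_deriv_def[of _ _ _ ?u] conf_deriv_def[of _ _ _ ?v]
      unfolding conf_deriv_def[of _ _ _ x t] conf_deriv_def[of _ _ _ y t]
      by (simp add: algebra_simps)
    then show ?thesis using assms(4) by (simp add: field_simps)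
  qed
  ultimately show ?thesis by simp
qed

theorem theorem3p6:
  fixes I :: "real set"
    and \<kappa>0 \<kappa>1 :: "real \<Rightarrow> real \<Rightarrow> real"
    and \<alpha> :: real
    and p q x y :: "real \<Rightarrow> real"
  assumes "nondegenerate_interval I"
    and "conformable_kernels I \<kappa>0 \<kappa>1"
    and "\<alpha> \<in> {0<..1}"
    and "continuous_on I p" and "\<And>t. t \<in> I \<Longrightarrow> p t > 0"
    and "continuous_on I q"
    and "x \<in> conf_domain (\<kappa>0 \<alpha>) (\<kappa>1 \<alpha>) I p"
    and "y \<in> conf_domain (\<kappa>0 \<alpha>) (\<kappa>1 \<alpha>) I p"
  shows "(\<lambda>s. p s * conf_wronskian (\<kappa>0 \<alpha>) (\<kappa>1 \<alpha>) I x y s) differentiable_on I \<and>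
         (\<forall>t\<in>I.
            x t * conf_L (\<kappa>0 \<alpha>) (\<kappa>1 \<alpha>) I p q y t - y t * conf_L (\<kappa>0 \<alpha>) (\<kappa>1 \<alpha>) I p q x t
            = conf_deriv (\<kappa>0 \<alpha>) (\<kappa>1 \<alpha>) I (\<lambda>s. p s * conf_wronskian (\<kappa>0 \<alpha>) (\<kappa>1 \<alpha>) I x y s) t
              + \<kappa>1 \<alpha> t * (p t * conf_wronskian (\<kappa>0 \<alpha>) (\<kappa>1 \<alpha>) I x y t)) \<and>
         (\<forall>b\<in>I.
            (\<lambda>s. p s * conf_wronskian (\<kappa>0 \<alpha>) (\<kappa>1 \<alpha>) I x y s / conf_exp0 (\<kappa>0 \<alpha>) (\<kappa>1 \<alpha>) s b)
              differentiable_on I \<and>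
            (\<forall>t\<in>I.
               conf_exp0 (\<kappa>0 \<alpha>) (\<kappa>1 \<alpha>) t b
               * conf_deriv (\<kappa>0 \<alpha>) (\<kappa>1 \<alpha>) I
                   (\<lambda>s. p s * conf_wronskian (\<kappa>0 \<alpha>) (\<kappa>1 \<alpha>) I x y s
                        / conf_exp0 (\<kappa>0 \<alpha>) (\<kappa>1 \<alpha>) s b) t
               = x t * conf_L (\<kappa>0 \<alpha>) (\<kappa>1 \<alpha>) I p q y t - y t * conf_L (\<kappa>0 \<alpha>) (\<kappa>1 \<alpha>) I p q x t))"
proof -
  let ?k0 = "\<kappa>0 \<alpha>" and ?k1 = "\<kappa>1 \<alpha>"
  let ?w = "\<lambda>s. p s * conf_wronskian ?k0 ?k1 I x y s"
  let ?R = "\<lambda>t. x t * conf_L ?k0 ?k1 I p q y t - y t * conf_L ?k0 ?k1 I p q x t"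
  let ?w' = "\<lambda>t. (?R t - 2 * ?k1 t * ?w t) / ?k0 t"
  have I: "is_interval I" using assms(1) by (simp add: nondegenerate_interval_def)
  have k0: "?k0 t \<noteq> 0" if "t \<in> I" for t
    using assms(2,3) that by (auto simp: conformable_kernels_def)
  have cont: "continuous_on I ?k0" "continuous_on I ?k1"
    using assms(2,3)
    by (auto simp: conformable_kernels_def intro!: continuous_on_slice[of "{0..1}" I])
  note nbot = at_within_nondegenerate_interval_neq_bot[OF assms(1)]
  have w: "(?w has_real_derivative ?w' t) (at t within I)" if "t \<in> I" for t
    using conf_wronskian_has_real_derivative[OF assms(7,8) that k0[OF that]] .
  have quot: "((\<lambda>s. ?w s / conf_exp0 ?k0 ?k1 s b) has_real_derivative
      (?w' t + ?k1 t / ?k0 t * ?w t) / conf_exp0 ?k0 ?k1 t b) (at t within I)"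
    if "b \<in> I" "t \<in> I" for b t
  proof -
    have e: "conf_exp0 ?k0 ?k1 t b \<noteq> 0" by (simp add: conf_exp0_def)
    \<comment> \<open>With \<open>r\<close> the quotient of the kernels, the derivative of
      \<open>e\<close> is \<open>- r * e\<close>, so one factor \<open>e\<close> cancels in the
      quotient rule.\<close>
    have alg: "(d * e - w * (- r * e)) / (e * e) = (d + r * w) / e" if "e \<noteq> 0" for d e w r :: real
    proof -
      have "d * e - w * (- r * e) = (d + r * w) * e" by (simp add: algebra_simps)
      then show ?thesis using that by simp
    qed
    show ?thesis
      using DERIV_divide[OF w[OF that(2)] conf_exp0_has_real_derivative[OF I cont k0 that] e]
      unfolding alg[OF e] .
  qed
  have w_diff: "?w differentiable_on I"
    unfolding differentiable_on_def real_differentiable_def using w by blast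
  \<comment> \<open>Multiplying \<open>?w' t\<close> by \<open>?k0 t\<close> gives
    \<open>?R t - 2 * ?k1 t * ?w t\<close>. The conformable derivative restores one
    \<open>?k1 t * ?w t\<close>, and the extra term in the identity restores the other.\<close>
  have w_eq: "?R t = conf_deriv ?k0 ?k1 I ?w t + ?k1 t * ?w t" if "t \<in> I" for t
    unfolding conf_deriv_eqI[OF nbot[OF that] w[OF that]] using k0[OF that] by simp
  have quot_diff: "(\<lambda>s. ?w s / conf_exp0 ?k0 ?k1 s b) differentiable_on I" if "b \<in> I" for b
    unfolding differentiable_on_def real_differentiable_def using quot[OF that] by blast
  have quot_eq: "conf_exp0 ?k0 ?k1 t b *
      conf_deriv ?k0 ?k1 I (\<lambda>s. ?w s / conf_exp0 ?k0 ?k1 s b) t = ?R t"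
    if "b \<in> I" "t \<in> I" for b t
  proof -
    have e: "conf_exp0 ?k0 ?k1 t b \<noteq> 0" by (simp add: conf_exp0_def)
    \<comment> \<open>Here the two copies of \<open>k1 * w\<close> that offset
      \<open>- 2 * k1 * w\<close> come from the conformable derivative itself and from
      differentiating \<open>1 / e\<close>.\<close>
    have alg: "e * (k1 * (w / e) + k0 * (((R - 2 * k1 * w) / k0 + k1 / k0 * w) / e)) = R"
      if "e \<noteq> 0" "k0 \<noteq> 0" for e k0 k1 w R :: real
      using that by (simp add: field_simps)
    show ?thesis
      unfolding conf_deriv_eqI[OF nbot[OF that(2)] quot[OF that]]
      by (rule alg[OF e k0[OF that(2)]])
  qed
  show ?thesis using w_diff w_eq quot_diff quot_eq by (intro conjI ballI)
qed

end
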